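(* Let $k$ be a positive integer and let $S_k(x)=\sum_{n\ge 1}s_k(RT_{2,n})x^n$ be the generating function of the number of staircase $(RT_{2,n},k)$-words, where $RT_{2,n}$ is the rectangle-triangular graph of size $2\times n$. Then $$S_k(x)=\frac{a_1(x,t_1,t_2)t_1^kt_2^k+a_2(x,t_1,t_2)t_1^k-a_2(x,t_2,t_1)t_2^k+a_3(x,t_1,t_2)}{(t_1-1)(t_2-1)(x^2-6x+1)\left(b_1(x,t_1,t_2)t_1^kt_2^k-b_2(x,t_1,t_2)t_1^k+b_2(x,t_2,t_1)t_2^k-b_3(x,t_1,t_2)\right)},$$ where \begin{align*} a_1(x,t_1,t_2)&=(t_2-t_1)\Big(\big((t_2-1)(t_1-1)k-2t_2t_1\big)x^5\\ &\quad+\big((t_1-1)(1-t_2)(t_1^2t_2+t_1t_2^2+t_1^2+t_1t_2+t_2^2+t_1+t_2+3)k+2t_1^3t_2^2+2t_1^2t_2^3+2t_2t_1+4t_1+4t_2\big)x^4\\ &\quad+\big((t_1-1)(t_2-1)(t_1^2t_2^2+4t_1^2t_2+4t_1t_2^2+3t_1^2+5t_1t_2+3t_2^2+4t_1+4t_2)k-2t_2t_1(t_1^2t_2+t_1t_2^2+3t_1t_2+1)\big)x^3\\ &\quad+\big((t_1-1)(1-t_2)(3t_1^2t_2^2+3t_1^2t_2+3t_1t_2^2+7t_1t_2+3t_1+3t_2)k-2t_1^3t_2^2-2t_1^2t_2^3+2t_1^2t_2^2-2t_2t_1-4t_1-4t_2\big)x^2\\ &\quad+\big(3t_2t_1(t_2-1)(t_1-1)k+2t_2t_1(t_1^2t_2+t_1t_2^2+3t_1t_2+2)\big)x-2t_1^2t_2^2\Big),\\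 a_2(x,t_1,t_2)&=(t_1t_2-1)\Big(\big(-t_2^2(t_2-1)(t_1-1)k-2t_2^2t_1\big)x^5\\ &\quad+\big((t_1-1)(t_2-1)(t_1^2t_2^2+t_1^2t_2+t_1t_2^2+t_1t_2+3t_2^2+t_1+t_2+1)k+2t_1^3t_2+4t_1t_2^3+2t_2^2t_1+2t_1^2+4t_2^2\big)x^4\\ &\quad+\big((t_1-1)(1-t_2)(3t_1^2t_2^2+4t_1^2t_2+4t_1t_2^2+t_1^2+5t_1t_2+4t_1+4t_2+3)k-2t_1(t_1^2t_2+3t_1t_2+t_2^2+t_1)\big)x^3\\ &\quad+\big((t_1-1)(t_2-1)(3t_1^2t_2+3t_1t_2^2+3t_1^2+7t_1t_2+3t_1+3t_2)k-2t_1^3t_2-4t_1t_2^3+2t_1^2t_2-2t_2^2t_1-2t_1^2-4t_2^2\big)x^2\\ &\quad+\big(3t_1t_2(t_1-1)(1-t_2)k+2t_1(t_1^2t_2+3t_1t_2+2t_2^2+t_1)\big)x-2t_1^2t_2\Big),\\ a_3(x,t_1,t_2)&=(t_1-t_2)\Big(\big(t_1^2t_2^2(t_1-1)(t_2-1)k-2t_1^2t_2^2\big)x^5\\ &\quad+\big((t_1-1)(1-t_2)(3t_1^2t_2^2+t_1^2t_2+t_1t_2^2+t_1^2+t_1t_2+t_2^2+t_1+t_2)k+4t_1^3t_2^2+4t_1^2t_2^3+2t_1^2t_2^2+2t_1+2t_2\big)x^4\\ &\quad+\big((t_1-1)(t_2-1)(4t_1^2t_2+4t_1t_2^2+3t_1^2+5t_1t_2+3t_2^2+4t_1+4t_2+1)k-2t_1^2t_2^2-6t_1t_2-2t_1-2t_2\big)x^3\\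 &\quad+\big((t_1-1)(1-t_2)(3t_1^2t_2+3t_1t_2^2+7t_1t_2+3t_1+3t_2+3)k-4t_1^3t_2^2-4t_1^2t_2^3-2t_1^2t_2^2+2t_1t_2-2t_1-2t_2\big)x^2\\ &\quad+\big(3t_1t_2(t_1-1)(t_2-1)k+4t_1^2t_2^2+6t_1t_2+2t_1+2t_2\big)x-2t_1t_2\Big),\\ b_1(x,t_1,t_2)&=(t_1-t_2)\Big((-t_1^2t_2-t_1t_2^2-t_1^2-t_1t_2-t_2^2-t_1-t_2)x^2\\ &\quad+(t_1^2t_2^2+t_1^2t_2+t_1t_2^2+2t_1t_2+t_1+t_2)x-t_2t_1\Big),\\ b_2(x,t_1,t_2)&=(t_1t_2-1)\Big((t_1^2t_2^2+t_1^2t_2+t_1t_2^2+t_1t_2+t_1+t_2+1)x^2\\ &\quad+(-t_1^2t_2-t_1t_2^2-t_1^2-2t_1t_2-t_1-t_2)x+t_2t_1\Big),\\ b_3(x,t_1,t_2)&=(t_1-t_2)\Big((-t_1^2t_2-t_1t_2^2-t_1^2-t_1t_2-t_2^2-t_1-t_2)x^2\\ &\quad+(t_1^2t_2+t_1t_2^2+2t_1t_2+t_1+t_2+1)x-t_2t_1\Big), \end{align*} and $$t_{1,2}=\frac{x(1-x)\mp x(1+x)\sqrt{x}}{2x^2}+\frac{\sqrt{x(1+x)(1-x)^2\pm 2x(x^2-1)\sqrt{x}}}{2x\sqrt{x}}$$ (upper signs for $t_1$, lower signs for $t_2$).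
   Context: For a positive integer $k$ write $[k]=\{1,\dots,k\}$. For a graph $G$ with vertex set $V$, a $(G,k)$-word is a function $w\colon V\to[k]$; it is called staircase if $|w(u)-w(v)|\le 1$ for all adjacent $u,v\in V$. The number of staircase $(G,k)$-words is denoted $s_k(G)$. The rectangle-triangular graph $RT_{2,n}$ of size $2\times n$ has vertex set $\{(i,j): i\in\{1,2\},\ 1\le j\le n\}$; two vertices $(i_1,j_1)$ and $(i_2,j_2)$ are adjacent if $|i_1-i_2|+|j_1-j_2|=1$, or $i_1=1,\ i_2=2,\ j_2=j_1+1$, or $i_1=2,\ i_2=1,\ j_2=j_1-1$. The notation $a_2(x,t_2,t_1)$, $b_2(x,t_2,t_1)$ means the same expressions with $t_1$ and $t_2$ interchanged. The quantities $t_1,1/t_1,t_2,1/t_2$ are the four roots in $t$ of $x^2t^4+2x(x-1)t^3+(1-3x+x^2-x^3)t^2+2x(x-1)t+x^2=0$.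
   Formalization: The printed b_1, b_2, b_3 lack their x^3 terms, so the formula fails (e.g. k=1); the proved version adds x^3, -t_2^2 x^3 and t_1^2 t_2^2 x^3 to the bracketed factors of b_1, b_2, b_3. The identity is read in formal Laurent series in √x. *)

theory Defs
  imports
    "HOL-Library.FuncSet"
    "HOL-Computational_Algebra.Formal_Laurent_Series"
begin

definition staircase_words :: "'v set \<Rightarrow> ('v \<Rightarrow> 'v \<Rightarrow> bool) \<Rightarrow> nat \<Rightarrow> ('v \<Rightarrow> int) set" where
  "staircase_words V adj k =
     {w \<in> V \<rightarrow>\<^sub>E {1..int k}. \<forall>u\<in>V. \<forall>v\<in>V. adj u v \<longrightarrow> \<bar>w u - w v\<bar> \<le> 1}"

definition staircase_count :: "'v set \<Rightarrow> ('v \<Rightarrow> 'v \<Rightarrow> bool) \<Rightarrow> nat \<Rightarrow> nat" where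
  "staircase_count V adj k = card (staircase_words V adj k)"

definition RT2_verts :: "nat \<Rightarrow> (int \<times> int) set" where
  "RT2_verts n = {1, 2} \<times> {1..int n}"

fun RT2_adj :: "int \<times> int \<Rightarrow> int \<times> int \<Rightarrow> bool" where
  "RT2_adj (i1, j1) (i2, j2) \<longleftrightarrow>
     \<bar>i1 - i2\<bar> + \<bar>j1 - j2\<bar> = 1 \<or>
     i1 = 1 \<and> i2 = 2 \<and> j2 = j1 + 1 \<or>
     i1 = 2 \<and> i2 = 1 \<and> j2 = j1 - 1"

definition staircase_gf :: "nat \<Rightarrow> real fps" where
  "staircase_gf k =
     Abs_fps (\<lambda>n. if n = 0 then 0 else of_nat (staircase_count (RT2_verts n) RT2_adj k))"

text \<open>
  The functions \<open>t\<^sub>1\<close> and \<open>t\<^sub>2\<close> involve \<open>\<surd>x\<close>, so the identity lives in the field of formal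
  Laurent series in \<open>q = \<surd>x\<close>: the variable \<open>x\<close> is the series \<open>q\<^sup>2\<close>. Square roots are the
  ones with positive leading coefficient, in agreement with the real square root for
  small positive arguments; in particular \<open>\<surd>(q\<^sup>2) = q\<close>. Only series that have such a root
  occur below.
\<close>

definition fls_sqrt :: "real fls \<Rightarrow> real fls" where
  "fls_sqrt f = (THE g. g ^ 2 = f \<and> fls_nth g (fls_subdegree g) > 0)"

definition t1_fun :: "real fls \<Rightarrow> real fls" where
  "t1_fun x =
     (x * (1 - x) - x * (1 + x) * fls_sqrt x) / (2 * x ^ 2)
     + fls_sqrt (x * (1 + x) * (1 - x) ^ 2 + 2 * x * (x ^ 2 - 1) * fls_sqrt x)
       / (2 * x * fls_sqrt x)"

definition t2_fun :: "real fls \<Rightarrow> real fls" where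
  "t2_fun x =
     (x * (1 - x) + x * (1 + x) * fls_sqrt x) / (2 * x ^ 2)
     + fls_sqrt (x * (1 + x) * (1 - x) ^ 2 - 2 * x * (x ^ 2 - 1) * fls_sqrt x)
       / (2 * x * fls_sqrt x)"

definition a1_poly :: "nat \<Rightarrow> 'a::comm_ring_1 \<Rightarrow> 'a \<Rightarrow> 'a \<Rightarrow> 'a" where
  "a1_poly k x u v =
      (v - u) * (((v - 1) * (u - 1) * of_nat k - 2 * v * u) * x ^ 5
       + ((u - 1) * (1 - v) * (u ^ 2 * v + u * v ^ 2 + u ^ 2 + u * v + v ^ 2 + u + v + 3) * of_nat k + 2 * u ^ 3 * v ^ 2 + 2 * u ^ 2 * v ^ 3 + 2 * v * u + 4 * u + 4 * v) * x ^ 4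
       + ((u - 1) * (v - 1) * (u ^ 2 * v ^ 2 + 4 * u ^ 2 * v + 4 * u * v ^ 2 + 3 * u ^ 2 + 5 * u * v + 3 * v ^ 2 + 4 * u + 4 * v) * of_nat k - 2 * v * u * (u ^ 2 * v + u * v ^ 2 + 3 * u * v + 1)) * x ^ 3
       + ((u - 1) * (1 - v) * (3 * u ^ 2 * v ^ 2 + 3 * u ^ 2 * v + 3 * u * v ^ 2 + 7 * u * v + 3 * u + 3 * v) * of_nat k - 2 * u ^ 3 * v ^ 2 - 2 * u ^ 2 * v ^ 3 + 2 * u ^ 2 * v ^ 2 - 2 * v * u - 4 * u - 4 * v) * x ^ 2
       + (3 * v * u * (v - 1) * (u - 1) * of_nat k + 2 * v * u * (u ^ 2 * v + u * v ^ 2 + 3 * u * v + 2)) * x - 2 * u ^ 2 * v ^ 2)"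

definition a2_poly :: "nat \<Rightarrow> 'a::comm_ring_1 \<Rightarrow> 'a \<Rightarrow> 'a \<Rightarrow> 'a" where
  "a2_poly k x u v =
      (u * v - 1) * ((-(v ^ 2) * (v - 1) * (u - 1) * of_nat k - 2 * v ^ 2 * u) * x ^ 5
       + ((u - 1) * (v - 1) * (u ^ 2 * v ^ 2 + u ^ 2 * v + u * v ^ 2 + u * v + 3 * v ^ 2 + u + v + 1) * of_nat k + 2 * u ^ 3 * v + 4 * u * v ^ 3 + 2 * v ^ 2 * u + 2 * u ^ 2 + 4 * v ^ 2) * x ^ 4
       + ((u - 1) * (1 - v) * (3 * u ^ 2 * v ^ 2 + 4 * u ^ 2 * v + 4 * u * v ^ 2 + u ^ 2 + 5 * u * v + 4 * u + 4 * v + 3) * of_nat k - 2 * u * (u ^ 2 * v + 3 * u * v + v ^ 2 + u)) * x ^ 3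
       + ((u - 1) * (v - 1) * (3 * u ^ 2 * v + 3 * u * v ^ 2 + 3 * u ^ 2 + 7 * u * v + 3 * u + 3 * v) * of_nat k - 2 * u ^ 3 * v - 4 * u * v ^ 3 + 2 * u ^ 2 * v - 2 * v ^ 2 * u - 2 * u ^ 2 - 4 * v ^ 2) * x ^ 2
       + (3 * u * v * (u - 1) * (1 - v) * of_nat k + 2 * u * (u ^ 2 * v + 3 * u * v + 2 * v ^ 2 + u)) * x - 2 * u ^ 2 * v)"

definition a3_poly :: "nat \<Rightarrow> 'a::comm_ring_1 \<Rightarrow> 'a \<Rightarrow> 'a \<Rightarrow> 'a" where
  "a3_poly k x u v =
      (u - v) * ((u ^ 2 * v ^ 2 * (u - 1) * (v - 1) * of_nat k - 2 * u ^ 2 * v ^ 2) * x ^ 5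
       + ((u - 1) * (1 - v) * (3 * u ^ 2 * v ^ 2 + u ^ 2 * v + u * v ^ 2 + u ^ 2 + u * v + v ^ 2 + u + v) * of_nat k + 4 * u ^ 3 * v ^ 2 + 4 * u ^ 2 * v ^ 3 + 2 * u ^ 2 * v ^ 2 + 2 * u + 2 * v) * x ^ 4
       + ((u - 1) * (v - 1) * (4 * u ^ 2 * v + 4 * u * v ^ 2 + 3 * u ^ 2 + 5 * u * v + 3 * v ^ 2 + 4 * u + 4 * v + 1) * of_nat k - 2 * u ^ 2 * v ^ 2 - 6 * u * v - 2 * u - 2 * v) * x ^ 3
       + ((u - 1) * (1 - v) * (3 * u ^ 2 * v + 3 * u * v ^ 2 + 7 * u * v + 3 * u + 3 * v + 3) * of_nat k - 4 * u ^ 3 * v ^ 2 - 4 * u ^ 2 * v ^ 3 - 2 * u ^ 2 * v ^ 2 + 2 * u * v - 2 * u - 2 * v) * x ^ 2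
       + (3 * u * v * (u - 1) * (v - 1) * of_nat k + 4 * u ^ 2 * v ^ 2 + 6 * u * v + 2 * u + 2 * v) * x - 2 * u * v)"

text \<open>
  The paper prints \<open>b\<^sub>1, b\<^sub>2, b\<^sub>3\<close> without their terms of degree \<open>3\<close> in \<open>x\<close>
  (the first summand of each right factor below). The formula then fails: for
  \<open>k = 1\<close>, where every coefficient is \<open>1\<close>, it gives \<open>-1\<close> at \<open>x\<^sup>5\<close>. The terms are restored
  here; up to sign and monomial factors, \<open>b\<^sub>2\<close> and \<open>b\<^sub>3\<close> arise from \<open>b\<^sub>1\<close> by inverting
  \<open>v\<close>, respectively both \<open>u\<close> and \<open>v\<close>.
\<close>

definition b1_poly :: "'a::comm_ring_1 \<Rightarrow> 'a \<Rightarrow> 'a \<Rightarrow> 'a" where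
  "b1_poly x u v =
      (u - v) * (x ^ 3 + (-(u ^ 2) * v - u * v ^ 2 - u ^ 2 - u * v - v ^ 2 - u - v) * x ^ 2
       + (u ^ 2 * v ^ 2 + u ^ 2 * v + u * v ^ 2 + 2 * u * v + u + v) * x - v * u)"

definition b2_poly :: "'a::comm_ring_1 \<Rightarrow> 'a \<Rightarrow> 'a \<Rightarrow> 'a" where
  "b2_poly x u v =
      (u * v - 1) * (-(v ^ 2) * x ^ 3 + (u ^ 2 * v ^ 2 + u ^ 2 * v + u * v ^ 2 + u * v + u + v + 1) * x ^ 2
       + (-(u ^ 2) * v - u * v ^ 2 - u ^ 2 - 2 * u * v - u - v) * x + v * u)"

definition b3_poly :: "'a::comm_ring_1 \<Rightarrow> 'a \<Rightarrow> 'a \<Rightarrow> 'a" where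
  "b3_poly x u v =
      (u - v) * (u ^ 2 * v ^ 2 * x ^ 3 + (-(u ^ 2) * v - u * v ^ 2 - u ^ 2 - u * v - v ^ 2 - u - v) * x ^ 2
       + (u ^ 2 * v + u * v ^ 2 + 2 * u * v + u + v + 1) * x - v * u)"

end

theory Submission
  imports Defs
begin

text \<open>
  Staircase words of \<open>RT\<^sub>2\<^sub>,\<^sub>n\<close> are integer paths of length \<open>2n\<close> in which entries at distance at most 2
  differ by at most 1. Let \<open>q = \<surd>x\<close> mark the length of such a path. Eliminating the generating
  functions of the paths that start with \<open>(m, m + 1)\<close> or \<open>(m + 1, m)\<close> leaves a three-term recurrence
  with constant coefficients for those that start with \<open>(m, m)\<close>; its characteristic equation is
  \<open>q\<^sup>2 (t\<^sup>2 + 1) = (1 - q - q\<^sup>2 - q\<^sup>3) t\<close>, with root \<open>t\<^sub>1\<close>. Replacing \<open>q\<close> by \<open>-q\<close> replaces \<open>t\<^sub>1\<close> by \<open>t\<^sub>2\<close>,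
  and the even part in \<open>q\<close> of the generating function of all nonempty paths is \<open>S\<^sub>k\<close>. Over a common
  denominator, the printed coefficients differ from this even part by the common factor
  \<open>-2 q (1 + q\<^sup>2)\<^sup>2 t\<^sub>1 t\<^sub>2\<close>, modulo the two characteristic equations.
\<close>

section \<open>Staircase words of a squared path\<close>

definition strip_paths :: "nat \<Rightarrow> nat \<Rightarrow> int list set" where
  "strip_paths k N = {xs. length xs = N \<and> set xs \<subseteq> {1..int k} \<and>
     (\<forall>j<N. \<forall>i<j. j \<le> i + 2 \<longrightarrow> \<bar>xs ! i - xs ! j\<bar> \<le> 1)}"

text \<open>
  Reading the vertices in the order \<open>(2,1), (1,1), (2,2), (1,2), \<dots>\<close> makes the graph the square of
  a path.
\<close>

definition strip_pos :: "nat \<Rightarrow> int \<times> int" where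
  "strip_pos i = (if even i then 2 else 1, int (i div 2) + 1)"

text \<open>Positions at distance 2 are horizontal neighbours. Positions at distance 1 form a
  vertical edge if the smaller one is even, and a diagonal one if it is odd.\<close>

lemma RT2_adj_strip_pos:
  "RT2_adj (strip_pos i) (strip_pos j) \<longleftrightarrow> i < j \<and> j \<le> i + 2 \<or> j < i \<and> i \<le> j + 2"
proof (cases "even i"; cases "even j")
  assume "even i" "even j"
  then obtain a b where "i = 2 * a" "j = 2 * b" by (elim evenE)
  thus ?thesis by (simp add: strip_pos_def) arith
next
  assume "even i" "odd j"
  then obtain a b where "i = 2 * a" "j = 2 * b + 1" by (elim evenE oddE)
  thus ?thesis by (simp add: strip_pos_def) arith
next
  assume "odd i" "even j"
  then obtain a b where "i = 2 * a + 1" "j = 2 * b" by (elim evenE oddE)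
  thus ?thesis by (simp add: strip_pos_def) arith
next
  assume "odd i" "odd j"
  then obtain a b where "i = 2 * a + 1" "j = 2 * b + 1" by (elim oddE)
  thus ?thesis by (simp add: strip_pos_def) arith
qed

lemma bij_betw_strip_pos: "bij_betw strip_pos {..<2 * n} (RT2_verts n)"
proof (rule bij_betw_byWitness[where f' = "\<lambda>(i, j). nat (2 * j - i)"])
  show "\<forall>i\<in>{..<2 * n}. (\<lambda>(i, j). nat (2 * j - i)) (strip_pos i) = i"
    by (auto simp: strip_pos_def elim!: evenE oddE)
  show "\<forall>p\<in>RT2_verts n. strip_pos ((\<lambda>(i, j). nat (2 * j - i)) p) = p"
    by (auto simp: strip_pos_def RT2_verts_def even_nat_iff nat_diff_distrib)
  show "strip_pos ` {..<2 * n} \<subseteq> RT2_verts n"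
    by (auto simp: strip_pos_def RT2_verts_def split: if_splits)
  show "(\<lambda>(i, j). nat (2 * j - i)) ` RT2_verts n \<subseteq> {..<2 * n}"
    by (auto simp: RT2_verts_def)
qed

text \<open>Listing the values along \<open>strip_pos\<close> turns words into lists. This is
  injective because words are extensional, and adjacency becomes nearness of positions.\<close>

lemma staircase_count_RT2: "staircase_count (RT2_verts n) RT2_adj k = card (strip_paths k (2 * n))"
proof -
  define V where "V = RT2_verts n"
  define rd where "rd w = map (\<lambda>i. w (strip_pos i)) [0..<2 * n]" for w :: "int \<times> int \<Rightarrow> int"
  have V: "V = strip_pos ` {..<2 * n}"
    using bij_betw_strip_pos by (auto simp: V_def bij_betw_def)
  have inj: "inj_on strip_pos {..<2 * n}" using bij_betw_strip_pos by (auto simp: bij_betw_def)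
  have adj: "(\<forall>u\<in>V. \<forall>v\<in>V. RT2_adj u v \<longrightarrow> \<bar>w u - w v\<bar> \<le> 1) \<longleftrightarrow>
     (\<forall>j<2 * n. \<forall>i<j. j \<le> i + 2 \<longrightarrow> \<bar>w (strip_pos i) - w (strip_pos j)\<bar> \<le> 1)"
    for w :: "int \<times> int \<Rightarrow> int"
  proof
    assume *: "\<forall>u\<in>V. \<forall>v\<in>V. RT2_adj u v \<longrightarrow> \<bar>w u - w v\<bar> \<le> 1"
    show "\<forall>j<2 * n. \<forall>i<j. j \<le> i + 2 \<longrightarrow> \<bar>w (strip_pos i) - w (strip_pos j)\<bar> \<le> 1"
    proof (intro allI impI)
      fix i j assume "j < 2 * n" "i < j" "j \<le> i + 2"
      thus "\<bar>w (strip_pos i) - w (strip_pos j)\<bar> \<le> 1"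
        by (intro *[rule_format]) (auto simp: V RT2_adj_strip_pos)
    qed
  next
    assume *: "\<forall>j<2 * n. \<forall>i<j. j \<le> i + 2 \<longrightarrow> \<bar>w (strip_pos i) - w (strip_pos j)\<bar> \<le> 1"
    show "\<forall>u\<in>V. \<forall>v\<in>V. RT2_adj u v \<longrightarrow> \<bar>w u - w v\<bar> \<le> 1"
    proof (intro ballI impI)
      fix u v assume "u \<in> V" "v \<in> V" and uv: "RT2_adj u v"
      then obtain i j where ij: "i < 2 * n" "j < 2 * n" "u = strip_pos i" "v = strip_pos j"
        by (auto simp: V)
      with uv have "i < j \<and> j \<le> i + 2 \<or> j < i \<and> i \<le> j + 2"
        by (simp only: RT2_adj_strip_pos)
      with * ij show "\<bar>w u - w v\<bar> \<le> 1" by (metis abs_minus_commute)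
    qed
  qed
  have "inj_on rd (V \<rightarrow>\<^sub>E {1..int k})"
  proof (rule inj_onI)
    fix w w' assume w: "w \<in> V \<rightarrow>\<^sub>E {1..int k}" "w' \<in> V \<rightarrow>\<^sub>E {1..int k}" "rd w = rd w'"
    show "w = w'"
      by (rule PiE_ext[OF w(1,2)]) (use w(3) in \<open>auto simp: V rd_def\<close>)
  qed
  moreover have "rd ` staircase_words V RT2_adj k = strip_paths k (2 * n)"
  proof (intro equalityI subsetI)
    fix xs assume "xs \<in> rd ` staircase_words V RT2_adj k"
    then show "xs \<in> strip_paths k (2 * n)"
      unfolding staircase_words_def adj
      by (auto simp: strip_paths_def rd_def V PiE_iff)
  next
    fix xs assume xs: "xs \<in> strip_paths k (2 * n)"
    define w where "w = restrict (\<lambda>p. xs ! the_inv_into {..<2 * n} strip_pos p) V"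
    have w: "w (strip_pos i) = xs ! i" if "i < 2 * n" for i
      using that inj by (auto simp: w_def V the_inv_into_f_f)
    have "rd w = xs"
      using xs by (intro nth_equalityI) (auto simp: rd_def w strip_paths_def)
    moreover have "w \<in> V \<rightarrow>\<^sub>E {1..int k}"
    proof (rule PiE_I)
      fix p assume "p \<in> V"
      then obtain i where i: "i < 2 * n" "p = strip_pos i" by (auto simp: V)
      hence "w p \<in> set xs" using xs by (auto simp: w strip_paths_def)
      thus "w p \<in> {1..int k}" using xs by (auto simp: strip_paths_def)
    qed (simp add: w_def)
    moreover have "\<forall>j<2 * n. \<forall>i<j. j \<le> i + 2 \<longrightarrow> \<bar>w (strip_pos i) - w (strip_pos j)\<bar> \<le> 1"
      using xs by (auto simp: w strip_paths_def)
    ultimately show "xs \<in> rd ` staircase_words V RT2_adj k"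
      unfolding staircase_words_def adj by blast
  qed
  moreover have "staircase_words V RT2_adj k \<subseteq> V \<rightarrow>\<^sub>E {1..int k}"
    by (auto simp: staircase_words_def)
  ultimately have "card (strip_paths k (2 * n)) = card (staircase_words V RT2_adj k)"
    using card_image inj_on_subset by metis
  thus ?thesis by (simp add: staircase_count_def V_def)
qed

lemma strip_paths_Cons:
  "a # b # c # xs \<in> strip_paths k (Suc (Suc (Suc N))) \<longleftrightarrow>
     a \<in> {1..int k} \<and> \<bar>a - b\<bar> \<le> 1 \<and> \<bar>a - c\<bar> \<le> 1 \<and> b # c # xs \<in> strip_paths k (Suc (Suc N))"
proof -
  \<comment> \<open>Index shift past the new entry: position 0 interacts only with positions 1 and
    2, which are the positions \<open>j \<le> 1\<close> of the tail.\<close>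
  have *: "(\<forall>i<Suc j. Suc j \<le> i + 2 \<longrightarrow> P i) \<longleftrightarrow> (j \<le> 1 \<longrightarrow> P 0) \<and> (\<forall>i<j. j \<le> i + 2 \<longrightarrow> P (Suc i))"
    for j :: nat and P
    unfolding All_less_Suc2 by auto
  have "(\<forall>j<Suc (Suc (Suc N)). \<forall>i<j. j \<le> i + 2 \<longrightarrow> \<bar>(a # b # c # xs) ! i - (a # b # c # xs) ! j\<bar> \<le> 1) \<longleftrightarrow>
    (\<forall>j<Suc (Suc N). j \<le> 1 \<longrightarrow> \<bar>a - (b # c # xs) ! j\<bar> \<le> 1) \<and>
    (\<forall>j<Suc (Suc N). \<forall>i<j. j \<le> i + 2 \<longrightarrow> \<bar>(b # c # xs) ! i - (b # c # xs) ! j\<bar> \<le> 1)"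
    by (subst All_less_Suc2) (simp only: * nth_Cons_0 nth_Cons_Suc, auto)
  also have "(\<forall>j<Suc (Suc N). j \<le> 1 \<longrightarrow> \<bar>a - (b # c # xs) ! j\<bar> \<le> 1) \<longleftrightarrow> \<bar>a - b\<bar> \<le> 1 \<and> \<bar>a - c\<bar> \<le> 1"
    by (auto simp: All_less_Suc2)
  finally show ?thesis unfolding strip_paths_def by auto
qed

text \<open>Constraints span three consecutive entries, so a pair of entries is the state of a
  transfer matrix; \<open>N\<close> counts only the entries after the pair.\<close>

definition strip_tails :: "nat \<Rightarrow> nat \<Rightarrow> int \<Rightarrow> int \<Rightarrow> nat" where
  "strip_tails k N a b = card {xs. a # b # xs \<in> strip_paths k (Suc (Suc N))}"

lemma finite_strip_paths: "finite (strip_paths k N)"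
  by (rule finite_subset[OF _ finite_lists_length_eq[of "{1..int k}" N]])
    (auto simp: strip_paths_def)

lemma finite_tails: "finite {xs. ys @ xs \<in> strip_paths k N}"
  using finite_vimageI[OF finite_strip_paths, of "(@) ys"] by (simp add: vimage_def inj_def)

lemma strip_tails_0:
  "strip_tails k 0 a b = (if a \<in> {1..int k} \<and> b \<in> {1..int k} \<and> \<bar>a - b\<bar> \<le> 1 then 1 else 0)"
proof -
  have "{xs. a # b # xs \<in> strip_paths k (Suc (Suc 0))} =
    (if a \<in> {1..int k} \<and> b \<in> {1..int k} \<and> \<bar>a - b\<bar> \<le> 1 then {[]} else {})"
    by (auto simp: strip_paths_def All_less_Suc)
  thus ?thesis by (simp add: strip_tails_def)
qed

lemma strip_tails_eq_0:
  assumes "\<not> (a \<in> {1..int k} \<and> b \<in> {1..int k} \<and> \<bar>a - b\<bar> \<le> 1)"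
  shows "strip_tails k N a b = 0"
proof -
  have "a # b # xs \<notin> strip_paths k (Suc (Suc N))" for xs
    using assms by (auto simp: strip_paths_def All_less_Suc2)
  thus ?thesis by (simp add: strip_tails_def)
qed

text \<open>Dropping \<open>a\<close> leaves a path with state \<open>(b, c)\<close>. The range of
  summation encodes the condition between \<open>a\<close> and \<open>c\<close>; a \<open>c\<close>
  that is invalid next to \<open>b\<close> contributes 0.\<close>

lemma strip_tails_Suc:
  assumes "a \<in> {1..int k}" "\<bar>a - b\<bar> \<le> 1"
  shows "strip_tails k (Suc N) a b = (\<Sum>c\<in>{a - 1..a + 1}. strip_tails k N b c)"
proof -
  have len: "length xs = Suc N" if "a # b # xs \<in> strip_paths k (Suc (Suc (Suc N)))" for xs
    using that by (simp add: strip_paths_def)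
  have eq: "{xs. a # b # xs \<in> strip_paths k (Suc (Suc (Suc N)))} =
    (\<Union>c\<in>{a - 1..a + 1}. (#) c ` {xs. b # c # xs \<in> strip_paths k (Suc (Suc N))})" (is "?l = ?r")
  proof (intro equalityI subsetI)
    fix xs assume xs: "xs \<in> ?l"
    then obtain c ys where "xs = c # ys" using len[of xs] by (cases xs) auto
    with xs show "xs \<in> ?r" by (intro UN_I[of c]) (auto simp: strip_paths_Cons)
  next
    fix xs assume "xs \<in> ?r"
    thus "xs \<in> ?l" using assms by (auto simp: strip_paths_Cons)
  qed
  have fin: "finite ((#) c ` {xs. b # c # xs \<in> strip_paths k (Suc (Suc N))})" for c
    using finite_tails[of "[b, c]"] by simp
  have "strip_tails k (Suc N) a b =
      (\<Sum>c\<in>{a - 1..a + 1}. card ((#) c ` {xs. b # c # xs \<in> strip_paths k (Suc (Suc N))}))"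
    unfolding strip_tails_def
    by (rule trans[OF arg_cong[OF eq, where f = card] card_UN_disjoint]) (use fin in auto)
  thus ?thesis by (simp add: strip_tails_def card_image)
qed

text \<open>Repeating the first entry turns a path into a longer one that starts with \<open>(m, m)\<close>.\<close>

lemma card_strip_paths:
  "card (strip_paths k (Suc (Suc N))) = (\<Sum>m=1..k. strip_tails k (Suc N) (int m) (int m))"
proof -
  have eq: "strip_paths k (Suc (Suc N)) =
    (\<Union>m\<in>{1..k}. (\<lambda>xs. int m # xs) ` {xs. int m # xs \<in> strip_paths k (Suc (Suc N))})"
  proof (intro equalityI subsetI)
    fix xs assume xs: "xs \<in> strip_paths k (Suc (Suc N))"
    then obtain a ys where "xs = a # ys" by (cases xs) (auto simp: strip_paths_def)
    moreover from this xs have "a \<in> {1..int k}" by (auto simp: strip_paths_def)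
    ultimately show "xs \<in> (\<Union>m\<in>{1..k}. (\<lambda>xs. int m # xs) ` {xs. int m # xs \<in> strip_paths k (Suc (Suc N))})"
      using xs by (intro UN_I[of "nat a"]) auto
  qed auto
  have fin: "finite ((#) (int m) ` {xs. int m # xs \<in> strip_paths k (Suc (Suc N))})" for m
    using finite_tails[of "[int m]"] by simp
  have "card (strip_paths k (Suc (Suc N))) =
      (\<Sum>m=1..k. card ((#) (int m) ` {xs. int m # xs \<in> strip_paths k (Suc (Suc N))}))"
    by (rule trans[OF arg_cong[OF eq, where f = card] card_UN_disjoint]) (use fin in auto)
  also have "\<dots> = (\<Sum>m=1..k. strip_tails k (Suc N) (int m) (int m))"
  proof (rule sum.cong[OF refl])
    fix m assume m: "m \<in> {1..k}"
    have "int m # xs \<in> strip_paths k (Suc (Suc N)) \<longleftrightarrow>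
        int m # int m # xs \<in> strip_paths k (Suc (Suc (Suc N)))" for xs
    proof (cases xs)
      case Nil
      thus ?thesis by (simp add: strip_paths_def)
    next
      case (Cons c ys)
      \<comment> \<open>This is the only condition of \<open>strip_paths_Cons\<close> on the
        repeated entry that is not immediate.\<close>
      have "\<bar>int m - c\<bar> \<le> 1" if "int m # c # ys \<in> strip_paths k (Suc (Suc N))"
        using that by (auto simp: strip_paths_def All_less_Suc2)
      thus ?thesis using m Cons by (auto simp: strip_paths_Cons)
    qed
    thus "card ((#) (int m) ` {xs. int m # xs \<in> strip_paths k (Suc (Suc N))}) =
        strip_tails k (Suc N) (int m) (int m)"
      by (simp add: strip_tails_def card_image)
  qed
  finally show ?thesis .
qed

section \<open>Solving the linear system\<close>

text \<open>
  With \<open>T = t\<^sup>k\<close>, the generating function of the paths of length at least 2 is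
  \<open>strip_num k q t T / ((1 - 2 q - q\<^sup>2) (t - 1) strip_den q t T)\<close>.
\<close>

definition strip_den :: "'a::comm_ring_1 \<Rightarrow> 'a \<Rightarrow> 'a \<Rightarrow> 'a" where
  "strip_den q t T = (1 + q * t) + (t + q) * T"

definition strip_num :: "nat \<Rightarrow> 'a::comm_ring_1 \<Rightarrow> 'a \<Rightarrow> 'a \<Rightarrow> 'a" where
  "strip_num k q t T = q^2 * (3 + q) * of_nat k * (t - 1) * strip_den q t T - 2 * (1 - q^2) * t * (T - 1)"

text \<open>The characteristic roots are \<open>t\<close> and its inverse, distinct by
  \<open>t^2 \<noteq> 1\<close>. The second solution is scaled so that reflecting \<open>m\<close>
  to \<open>Suc k - m\<close> swaps the two.\<close>

lemma symmetric_recurrence_solution: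
  fixes E :: "nat \<Rightarrow> 'a::field"
  assumes t: "t \<noteq> 0" "t^2 \<noteq> 1"
    and rec: "\<And>m. m < k \<Longrightarrow> t * (E m + E (Suc (Suc m))) = (t^2 + 1) * E (Suc m)"
  obtains A B where "\<And>m. m \<le> Suc k \<Longrightarrow> E m = A * t ^ m + B * t ^ (Suc k - m)"
proof -
  define T where "T = t ^ k"
  \<comment> \<open>Cramer's rule for the values at 0 and 1.\<close>
  define A where "A = (t * E 1 - E 0) / (t^2 - 1)"
  define B where "B = (t * E 0 - E 1) / (T * (t^2 - 1))"
  have A: "A * (t^2 - 1) = t * E 1 - E 0" and B: "B * T * (t^2 - 1) = t * E 0 - E 1"
    using t by (simp_all add: A_def B_def T_def)
  have "E m = A * t ^ m + B * t ^ (Suc k - m) \<and> E (Suc m) = A * t ^ Suc m + B * t ^ (k - m)"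
    if "m \<le> k" for m
    using that
  proof (induction m)
    case 0
    have "(t^2 - 1) * E 0 = (t^2 - 1) * (A + B * T * t)"
      using A B by algebra
    moreover have "(t^2 - 1) * E 1 = (t^2 - 1) * (A * t + B * T)"
      using A B by algebra
    ultimately show ?case using t(2) by (simp add: T_def mult_ac)
  next
    case (Suc m)
    then obtain d where d: "k = Suc m + d" using le_Suc_ex by blast
    define a b where "a = t ^ m" and "b = t ^ d"
    have "E m = A * a + B * (t^2 * b)" "E (Suc m) = A * (t * a) + B * (t * b)"
      using Suc d by (simp_all add: a_def b_def power2_eq_square mult_ac Suc_diff_le)
    moreover have "t * (E m + E (Suc (Suc m))) = (t^2 + 1) * E (Suc m)"
      using rec d by simp
    ultimately have "t * E (Suc (Suc m)) = t * (A * (t * (t * a)) + B * b)"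
      by algebra
    hence "E (Suc (Suc m)) = A * t ^ Suc (Suc m) + B * t ^ (k - Suc m)"
      using t(1) d by (simp add: a_def b_def)
    thus ?case using Suc by simp
  qed
  hence "E m = A * t ^ m + B * t ^ (Suc k - m)" if "m \<le> Suc k" for m
    using that by (cases m) auto
  thus thesis by (rule that)
qed

text \<open>\<open>D m\<close>, \<open>U m\<close>, \<open>L m\<close> stand for the series of paths
  starting with \<open>(m, m)\<close>, \<open>(m, m + 1)\<close>, \<open>(m + 1, m)\<close>, where
  \<open>q\<close> marks the entries after the first two. Since \<open>D\<close> also counts each
  shorter path with its first entry repeated, \<open>q * ((\<Sum>m=1..k. D m) - of_nat k)\<close>
  counts the paths of length at least 2 by length.\<close>

lemma strip_system_sum:
  fixes D U L :: "nat \<Rightarrow> 'a::field"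
  assumes k: "k \<ge> 1" and q: "q \<noteq> 0" "q^2 \<noteq> 1" "1 - 2 * q - q^2 \<noteq> 0"
    and t: "t \<noteq> 0" "t^2 \<noteq> 1" and curve: "q^2 * (t^2 + 1) = (1 - q - q^2 - q^3) * t"
    and nz: "1 + q * t \<noteq> (t + q) * t ^ k" "strip_den q t (t ^ k) \<noteq> 0"
    and D: "\<And>m. m < k \<Longrightarrow> D (Suc m) = 1 + q * (D (Suc m) + U (Suc m) + L m)"
    and U: "\<And>m. 1 \<le> m \<Longrightarrow> m < k \<Longrightarrow> U m = 1 + q * (L m + D (Suc m))"
    and L: "\<And>m. 1 \<le> m \<Longrightarrow> m < k \<Longrightarrow> L m = 1 + q * (U m + D m)"
    and bd: "U k = 0" "L 0 = 0"
  shows "q * ((\<Sum>m=1..k. D m) - of_nat k) * ((1 - 2 * q - q^2) * (t - 1) * strip_den q t (t ^ k))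
    = strip_num k q t (t ^ k)"
proof -
  define T where "T = t ^ k"
  define c where "c = (1 + q) / (1 - 2 * q - q^2)"
  have c: "c * (1 - 2 * q - q^2) = 1 + q" using q by (simp add: c_def)
  \<comment> \<open>The values at \<open>0\<close> and \<open>k + 1\<close> are chosen so that the formulas for \<open>L\<close> and \<open>U\<close> in terms
    of \<open>D'\<close> also give the boundary conditions.\<close>
  define D' where "D' m = (if m = 0 then - (1 + q) / q - q * D 1
      else if m = Suc k then - (1 + q) / q - q * D k else D m)" for m
  have D'0: "q * D' 0 = - (1 + q) - q^2 * D' 1" and D'k: "q * D' (Suc k) = - (1 + q) - q^2 * D' k"
    using k q(1) by (auto simp: D'_def field_simps power2_eq_square)
  have L': "(1 - q^2) * L m = 1 + q + q * D' m + q^2 * D' (Suc m)" if "m < k" for m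
  proof (cases "m = 0")
    case True
    thus ?thesis using D'0 bd by simp
  next
    case False
    with that have D'm: "D' m = D m" "D' (Suc m) = D (Suc m)" by (auto simp: D'_def)
    have "U m = 1 + q * (L m + D (Suc m))" "L m = 1 + q * (U m + D m)"
      using U[of m] L[of m] False that by auto
    thus ?thesis unfolding D'm by algebra
  qed
  have U': "(1 - q^2) * U m = 1 + q + q * D' (Suc m) + q^2 * D' m" if "1 \<le> m" "m \<le> k" for m
  proof (cases "m = k")
    case True
    thus ?thesis using D'k bd by simp
  next
    case False
    with that have D'm: "D' m = D m" "D' (Suc m) = D (Suc m)" by (auto simp: D'_def)
    have "U m = 1 + q * (L m + D (Suc m))" "L m = 1 + q * (U m + D m)"
      using U[of m] L[of m] False that by auto
    thus ?thesis unfolding D'm by algebra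
  qed
  \<comment> \<open>\<open>c\<close> is the constant solution of the recurrence for \<open>D'\<close>.\<close>
  have rec: "t * ((D' m - c) + (D' (Suc (Suc m)) - c)) = (t^2 + 1) * (D' (Suc m) - c)"
    if "m < k" for m
  proof -
    have "D' (Suc m) = 1 + q * (D' (Suc m) + U (Suc m) + L m)"
      using D[OF that] that by (simp add: D'_def)
    moreover have "(1 - q^2) * L m = 1 + q + q * D' m + q^2 * D' (Suc m)"
      using L' that by simp
    moreover have "(1 - q^2) * U (Suc m) = 1 + q + q * D' (Suc (Suc m)) + q^2 * D' (Suc m)"
      using U'[of "Suc m"] that by simp
    ultimately have "q^2 * ((D' m - c) + (D' (Suc (Suc m)) - c)) = (1 - q - q^2 - q^3) * (D' (Suc m) - c)"
      using c by algebra
    hence "q^2 * (t * ((D' m - c) + (D' (Suc (Suc m)) - c))) = q^2 * ((t^2 + 1) * (D' (Suc m) - c))"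
      using curve by algebra
    thus ?thesis using q(1) by simp
  qed
  obtain A B where sol: "\<And>m. m \<le> Suc k \<Longrightarrow> D' m - c = A * t ^ m + B * t ^ (Suc k - m)"
    using symmetric_recurrence_solution[OF t, where E = "\<lambda>m. D' m - c"] rec by blast
  have ends: "D' 0 - c = A + B * t * T" "D' 1 - c = A * t + B * T"
    "D' k - c = A * T + B * t" "D' (Suc k) - c = A * t * T + B"
    using sol[of 0] sol[of 1] sol[of k] sol[of "Suc k"] k by (simp_all add: T_def Suc_diff_le mult_ac)
  \<comment> \<open>Subtracting the two boundary relations isolates the antisymmetric part. Its
    factor is nonzero, so the solution is invariant under reflection.\<close>
  have "(A - B) * ((1 + q * t) - (t + q) * T) * q = 0"
    using ends D'0 D'k by algebra
  with nz q(1) have AB: "B = A" by (simp add: T_def)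
  \<comment> \<open>The relation at 0 now fixes \<open>A\<close>; the factor
    \<open>1 - 2 * q - q^2\<close> clears the denominator of \<open>c\<close>.\<close>
  have Ad: "q * (1 - 2 * q - q^2) * A * strip_den q t T = - (1 + q) * (1 - q)"
    using ends D'0 c unfolding AB strip_den_def by algebra
  have Dm: "D m = c + A * (t ^ m + t ^ (Suc k - m))" if "m \<in> {1..k}" for m
    using sol[of m] that unfolding AB by (auto simp: D'_def algebra_simps)
  have geo: "(t - 1) * (\<Sum>m=1..k. t ^ m) = t * (T - 1)"
    unfolding T_def by (induction k) (auto simp: algebra_simps)
  have rev: "(\<Sum>m=1..k. t ^ (Suc k - m)) = (\<Sum>m=1..k. t ^ m)"
    by (rule sum.reindex_bij_witness[of _ "\<lambda>m. Suc k - m" "\<lambda>m. Suc k - m"]) auto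
  have "(\<Sum>m=1..k. D m) = (\<Sum>m=1..k. c + A * (t ^ m + t ^ (Suc k - m)))"
    by (rule sum.cong[OF refl Dm])
  also have "\<dots> = of_nat k * c + A * (2 * (\<Sum>m=1..k. t ^ m))"
    unfolding sum.distrib sum_distrib_left[symmetric] rev by simp
  finally have "(\<Sum>m=1..k. D m) = of_nat k * c + A * (2 * (\<Sum>m=1..k. t ^ m))" .
  hence S: "(t - 1) * (\<Sum>m=1..k. D m) = (t - 1) * of_nat k * c + 2 * A * t * (T - 1)"
    using geo by algebra
  define \<sigma> w d where "\<sigma> = (\<Sum>m=1..k. D m)" and "w = 1 - 2 * q - q^2" and "d = strip_den q t T"
  have "q * (\<sigma> - of_nat k) * (w * (t - 1) * d) = q * w * d * ((t - 1) * \<sigma>) - q * w * d * ((t - 1) * of_nat k)"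
    by (simp add: algebra_simps)
  also have "\<dots> = q * d * (t - 1) * of_nat k * (c * w - w) + 2 * t * (T - 1) * (q * w * A * d)"
    unfolding S[folded \<sigma>_def] by (simp add: algebra_simps)
  also have "\<dots> = q * d * (t - 1) * of_nat k * (1 + q - w) + 2 * t * (T - 1) * (- (1 + q) * (1 - q))"
    unfolding c[folded w_def] Ad[folded w_def d_def] ..
  also have "\<dots> = strip_num k q t T"
    by (simp add: strip_num_def w_def d_def algebra_simps power2_eq_square)
  finally show ?thesis by (simp only: \<sigma>_def w_def d_def T_def)
qed

section \<open>The polynomial identities behind the printed coefficients\<close>

text \<open>
  After multiplication by \<open>q\<^sup>2\<close>, the difference of the two sides is in the ideal generated by the
  two relations.
\<close>

lemma strip_den_product:
  fixes q u v U V :: "'a::field"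
  assumes "q \<noteq> 0"
    and "q^2 * (u^2 + 1) = (1 - q - q^2 - q^3) * u" "q^2 * (v^2 + 1) = (1 + q - q^2 + q^3) * v"
  shows "b1_poly (q^2) u v * U * V - b2_poly (q^2) u v * U + b2_poly (q^2) v u * V - b3_poly (q^2) u v
    = -2 * q * (1 + q^2)^2 * u * v * (strip_den q u U * strip_den (- q) v V)"
proof -
  have "q^2 * (b1_poly (q^2) u v * U * V - b2_poly (q^2) u v * U + b2_poly (q^2) v u * V - b3_poly (q^2) u v)
    = q^2 * (-2 * q * (1 + q^2)^2 * u * v * (strip_den q u U * strip_den (- q) v V))"
    using assms(2,3) unfolding b1_poly_def b2_poly_def b3_poly_def strip_den_def by algebra
  moreover have "q^2 \<noteq> 0" using \<open>q \<noteq> 0\<close> by simp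
  ultimately show ?thesis using mult_left_cancel by blast
qed

text \<open>The bracket is the numerator of the sum of the two fractions for \<open>q\<close> and
  \<open>-q\<close> over their common denominator. That sum is twice the even part, whence the 2 on
  the left.\<close>

lemma strip_num_combination:
  fixes q u v U V :: "'a::field"
  assumes "q \<noteq> 0"
    and "q^2 * (u^2 + 1) = (1 - q - q^2 - q^3) * u" "q^2 * (v^2 + 1) = (1 + q - q^2 + q^3) * v"
  shows "2 * (a1_poly k (q^2) u v * U * V + a2_poly k (q^2) u v * U - a2_poly k (q^2) v u * V + a3_poly k (q^2) u v)
    = -2 * q * (1 + q^2)^2 * u * v *
      (strip_num k q u U * (1 + 2 * q - q^2) * (v - 1) * strip_den (- q) v V
       + strip_num k (- q) v V * (1 - 2 * q - q^2) * (u - 1) * strip_den q u U)"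
proof -
  have "q^2 * (2 * (a1_poly k (q^2) u v * U * V + a2_poly k (q^2) u v * U - a2_poly k (q^2) v u * V + a3_poly k (q^2) u v))
    = q^2 * (-2 * q * (1 + q^2)^2 * u * v *
      (strip_num k q u U * (1 + 2 * q - q^2) * (v - 1) * strip_den (- q) v V
       + strip_num k (- q) v V * (1 - 2 * q - q^2) * (u - 1) * strip_den q u U))"
    using assms(2,3) unfolding a1_poly_def a2_poly_def a3_poly_def strip_num_def strip_den_def by algebra
  moreover have "q^2 \<noteq> 0" using \<open>q \<noteq> 0\<close> by simp
  ultimately show ?thesis using mult_left_cancel by blast
qed

section \<open>The roots as Laurent series\<close>

text \<open>The only other square root is \<open>- g\<close>, whose leading coefficient is
  negative.\<close>

lemma fls_sqrt_eqI:
  assumes "g ^ 2 = f" "fls_nth g (fls_subdegree g) > 0"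
  shows "fls_sqrt f = g"
  unfolding fls_sqrt_def
proof (rule the_equality)
  show "g ^ 2 = f \<and> fls_nth g (fls_subdegree g) > 0" using assms by blast
next
  fix h assume h: "h ^ 2 = f \<and> fls_nth h (fls_subdegree h) > 0"
  hence "h ^ 2 = g ^ 2" using assms(1) by simp
  hence "h = g \<or> h = - g" by (simp only: power2_eq_iff)
  moreover have "h \<noteq> - g"
  proof
    assume "h = - g"
    hence "fls_nth h (fls_subdegree h) = - fls_nth g (fls_subdegree g)" by simp
    thus False using h assms(2) by linarith
  qed
  ultimately show "h = g" by blast
qed

lemma fls_sqrt_X_square: "fls_sqrt (fls_X ^ 2) = fls_X"
  by (rule fls_sqrt_eqI) simp_all

lemma fls_sqrt_shifted_unit:
  fixes p :: "real fps"
  assumes "fps_nth p 0 = 1"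
  obtains r where "fps_nth r 0 = 1" "r ^ 2 = p" "fls_sqrt (fls_X ^ 2 * fps_to_fls p) = fls_X * fps_to_fls r"
proof -
  \<comment> \<open>The constant function 1 selects 1 as the square root of the constant
    term.\<close>
  define r where "r = fps_radical (\<lambda>_ _. 1) 2 p"
  have r0: "fps_nth r 0 = 1"
    using assms by (simp add: r_def)
  have r2: "r ^ 2 = p"
    using assms power_radical[of p "\<lambda>_ _. 1" 1] by (simp add: r_def numeral_2_eq_2)
  have "fls_sqrt (fls_X ^ 2 * fps_to_fls p) = fls_X * fps_to_fls r"
  proof (rule fls_sqrt_eqI)
    show "(fls_X * fps_to_fls r) ^ 2 = fls_X ^ 2 * fps_to_fls p"
      unfolding power_mult_distrib fps_to_fls_power[symmetric] r2 ..
    have "subdegree r = 0" "r \<noteq> 0" using r0 by auto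
    hence "fls_subdegree (fls_X * fps_to_fls r) = 1"
      by (simp add: fls_subdegree_fls_to_fps)
    thus "fls_nth (fls_X * fps_to_fls r) (fls_subdegree (fls_X * fps_to_fls r)) > 0"
      using r0 by (simp add: fls_X_times_conv_shift)
  qed
  thus thesis using r0 r2 that by blast
qed

text \<open>\<open>s = 1\<close> gives \<open>t1\<close> and \<open>s = -1\<close> gives
  \<open>t2\<close>. The divisor contains \<open>fls_X\<close> for both signs, as it comes from the
  positive root of \<open>x\<close>; it cancels the \<open>fls_X\<close> in the outer square
  root.\<close>

lemma root_series:
  fixes q t x :: "real fls"
  assumes s: "s = 1 \<or> s = -1" and q: "q = fps_to_fls (fps_const s * fps_X)" and x: "x = fls_X ^ 2"
    and t: "t = (x * (1 - x) - x * (1 + x) * q) / (2 * x ^ 2)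
      + fls_sqrt (x * (1 + x) * (1 - x) ^ 2 + 2 * x * (x ^ 2 - 1) * q) / (2 * x * fls_X)"
  obtains \<tau> where "q^2 * (t^2 + 1) = (1 - q - q^2 - q^3) * t"
    "q^2 * t = fps_to_fls \<tau>" "fps_nth \<tau> 0 = 1"
proof -
  define Q :: "real fps" where "Q = fps_const s * fps_X"
  have qQ: "q = fps_to_fls Q" and Q0: "fps_nth Q 0 = 0" by (simp_all add: q Q_def)
  have "Q \<noteq> 0" using s by (auto simp: Q_def)
  hence q0: "q \<noteq> 0" unfolding qQ by simp
  have "Q^2 = fps_X^2" using s by (auto simp: Q_def power_mult_distrib)
  hence "fps_to_fls (Q^2) = fps_to_fls (fps_X^2)" by (rule arg_cong)
  hence xq: "x = q^2" by (simp only: x qQ fps_to_fls_power fps_X_to_fls)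
  define p where "p = (1 + Q^2) * (1 - Q^2)^2 + 2 * (Q^4 - 1) * Q"
  have "fps_nth p 0 = 1"
    using Q0 by (simp add: p_def power2_eq_square)
  then obtain r where r: "fps_nth r 0 = 1" "r^2 = p"
      "fls_sqrt (fls_X^2 * fps_to_fls p) = fls_X * fps_to_fls r"
    by (rule fls_sqrt_shifted_unit)
  have p: "fps_to_fls p = (1 + q^2) * (1 - q^2)^2 + 2 * (q^4 - 1) * q"
    by (simp add: p_def qQ fls_times_fps_to_fls fps_to_fls_power)
  hence r_sq: "fps_to_fls r ^ 2 = (1 + q^2) * (1 - q^2)^2 + 2 * (q^4 - 1) * q"
    by (simp add: r(2) flip: fps_to_fls_power)
  have "x * (1 + x) * (1 - x)^2 + 2 * x * (x^2 - 1) * q = fls_X^2 * fps_to_fls p"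
    unfolding p x[symmetric] xq by algebra
  hence "fls_sqrt (x * (1 + x) * (1 - x)^2 + 2 * x * (x^2 - 1) * q) = fls_X * fps_to_fls r"
    using r(3) by simp
  hence two_qt: "2 * (q^2 * t) = (1 - q^2 - (1 + q^2) * q) + fps_to_fls r"
    using q0 unfolding t xq by (simp add: field_simps power2_eq_square)
  define \<tau> where "\<tau> = fps_const (1/2) * ((1 - Q^2 - (1 + Q^2) * Q) + r)"
  have "2 * \<tau> = (1 - Q^2 - (1 + Q^2) * Q) + r"
    by (simp add: \<tau>_def numeral_fps_const flip: mult.assoc)
  hence "fps_to_fls (2 * \<tau>) = 2 * (q^2 * t)"
    unfolding two_qt by (simp add: qQ fls_times_fps_to_fls fps_to_fls_power)
  hence \<tau>: "q^2 * t = fps_to_fls \<tau>" by (simp add: fls_times_fps_to_fls)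
  \<comment> \<open>By \<open>r_sq\<close>, \<open>r\<close> is a square root of the discriminant
    \<open>(1 - q - q^2 - q^3)^2 - 4 * q^4\<close>, so \<open>two_qt\<close> is the quadratic
    formula.\<close>
  have "(4 * q^2) * (q^2 * (t^2 + 1)) = (4 * q^2) * ((1 - q - q^2 - q^3) * t)"
    using two_qt r_sq by algebra
  moreover have "4 * q^2 \<noteq> 0" using q0 by simp
  ultimately have "q^2 * (t^2 + 1) = (1 - q - q^2 - q^3) * t" using mult_left_cancel by blast
  moreover have "fps_nth \<tau> 0 = 1"
    using r(1) Q0 by (simp add: \<tau>_def power2_eq_square)
  ultimately show thesis using \<tau> that by blast
qed

text \<open>
  The root \<open>t\<close> has a pole of order 2 at \<open>q = 0\<close>, so the term \<open>(t + q) t\<^sup>k\<close> dominates.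
\<close>

lemma large_root_nonvanishing:
  fixes q t :: "'a::field fls"
  assumes q: "q = fps_to_fls Q" "fps_nth Q 0 = 0"
    and \<tau>: "q^2 * t = fps_to_fls \<tau>" "fps_nth \<tau> 0 = 1"
  shows "t \<noteq> 0" "t^2 \<noteq> 1" "1 + q * t \<noteq> (t + q) * t ^ k" "strip_den q t (t ^ k) \<noteq> 0"
proof -
  show "t \<noteq> 0" using \<tau> by auto
  show "t^2 \<noteq> 1"
  proof
    assume "t^2 = 1"
    hence "(q^2 * t)^2 = (q^2)^2" by (simp add: power_mult_distrib)
    hence "fps_to_fls \<tau> ^ 2 = (q^2)^2" by (simp only: \<tau>(1))
    hence "fps_to_fls (\<tau>^2) = fps_to_fls ((Q^2)^2)" by (simp only: q(1) fps_to_fls_power)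
    hence "fps_nth (\<tau>^2) 0 = fps_nth ((Q^2)^2) 0" by (simp only: fps_to_fls_eq_iff)
    thus False using q(2) \<tau>(2) by (simp add: power2_eq_square)
  qed
  \<comment> \<open>Multiplication by \<open>q ^ (2 * k + 2)\<close> makes both terms power series.
    The constant term of \<open>A\<close> is 0 and that of \<open>B\<close> is 1, so
    \<open>A\<close> is neither \<open>B\<close> nor \<open>- B\<close>.\<close>
  define A B where "A = Q ^ (2 * k + 1) * (Q + \<tau>)" and "B = (\<tau> + Q^3) * \<tau> ^ k"
  have A: "q ^ (2 * k + 2) * (1 + q * t) = fps_to_fls A"
    unfolding A_def fls_times_fps_to_fls fps_to_fls_plus fps_to_fls_power \<tau>(1)[symmetric] q(1)[symmetric]
    by (simp add: algebra_simps power2_eq_square)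
  have B: "q ^ (2 * k + 2) * ((t + q) * t ^ k) = fps_to_fls B"
    unfolding B_def fls_times_fps_to_fls fps_to_fls_plus fps_to_fls_power \<tau>(1)[symmetric] q(1)[symmetric]
    by (simp add: algebra_simps power2_eq_square power3_eq_cube power_mult power_mult_distrib)
  have "fps_nth A 0 \<noteq> fps_nth B 0" "fps_nth A 0 \<noteq> fps_nth (- B) 0"
    using q(2) \<tau>(2) by (simp_all add: A_def B_def fps_power_zeroth)
  hence "A \<noteq> B" "A \<noteq> - B" by metis+
  hence ne: "fps_to_fls A \<noteq> fps_to_fls B" "fps_to_fls A \<noteq> - fps_to_fls B"
    by (simp_all flip: fps_to_fls_uminus)
  show "1 + q * t \<noteq> (t + q) * t ^ k"
    using ne(1) unfolding A[symmetric] B[symmetric] by metis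
  show "strip_den q t (t ^ k) \<noteq> 0"
  proof
    assume "strip_den q t (t ^ k) = 0"
    hence "1 + q * t = - ((t + q) * t ^ k)" by (simp add: strip_den_def eq_neg_iff_add_eq_0)
    with ne(2) show False unfolding A[symmetric] B[symmetric] by simp
  qed
qed

section \<open>The generating function\<close>

text \<open>The factor \<open>s ^ n\<close> replaces the variable \<open>q\<close> by
  \<open>s * q\<close>; with \<open>s = 1\<close> and \<open>s = -1\<close> one linear system serves
  both \<open>t1\<close> and \<open>t2\<close>.\<close>

definition tails_fps :: "nat \<Rightarrow> real \<Rightarrow> int \<Rightarrow> int \<Rightarrow> real fps" where
  "tails_fps k s a b = Abs_fps (\<lambda>n. s ^ n * of_nat (strip_tails k n a b))"

lemma tails_fps_eq_0:
  assumes "\<not> (a \<in> {1..int k} \<and> b \<in> {1..int k} \<and> \<bar>a - b\<bar> \<le> 1)"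
  shows "tails_fps k s a b = 0"
  by (rule fps_ext) (simp add: tails_fps_def strip_tails_eq_0[OF assms])

lemma tails_fps_step:
  assumes "a \<in> {1..int k}" "b \<in> {1..int k}" "\<bar>a - b\<bar> \<le> 1"
  shows "tails_fps k s a b = 1 + fps_const s * fps_X *
    (tails_fps k s b (a - 1) + tails_fps k s b a + tails_fps k s b (a + 1))"
proof (rule fps_ext)
  fix n
  have "{a - 1..a + 1} = {a - 1, a, a + 1}" by auto
  thus "fps_nth (tails_fps k s a b) n = fps_nth (1 + fps_const s * fps_X *
    (tails_fps k s b (a - 1) + tails_fps k s b a + tails_fps k s b (a + 1))) n"
    using assms
    by (cases n) (simp_all add: tails_fps_def strip_tails_0 strip_tails_Suc mult.assoc algebra_simps)
qed

lemma fps_to_fls_sum: "(\<Sum>m\<in>A. fps_to_fls (f m)) = fps_to_fls (\<Sum>m\<in>A. f m)"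
  by (induction A rule: infinite_finite_induct) simp_all

lemma tails_fps_sum:
  fixes q t :: "real fls"
  assumes k: "k \<ge> 1" and s: "s = 1 \<or> s = -1" and q: "q = fps_to_fls (fps_const s * fps_X)"
    and curve: "q^2 * (t^2 + 1) = (1 - q - q^2 - q^3) * t"
    and \<tau>: "q^2 * t = fps_to_fls \<tau>" "fps_nth \<tau> 0 = 1"
  shows "q * (fps_to_fls (\<Sum>m=1..k. tails_fps k s (int m) (int m)) - of_nat k) *
    ((1 - 2 * q - q^2) * (t - 1) * strip_den q t (t ^ k)) = strip_num k q t (t ^ k)"
proof -
  define D where "D m = fps_to_fls (tails_fps k s (int m) (int m))" for m
  define U where "U m = fps_to_fls (tails_fps k s (int m) (int m + 1))" for m
  define L where "L m = fps_to_fls (tails_fps k s (int m + 1) (int m))" for m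
  define Q where "Q = fps_const s * fps_X"
  have Q: "q = fps_to_fls Q" "fps_nth Q 0 = 0" by (simp_all add: Q_def q)
  note nz = large_root_nonvanishing[OF Q \<tau>]
  have step: "fps_to_fls (tails_fps k s a b) = 1 + q *
    (fps_to_fls (tails_fps k s b (a - 1)) + fps_to_fls (tails_fps k s b a)
      + fps_to_fls (tails_fps k s b (a + 1)))"
    if "a \<in> {1..int k}" "b \<in> {1..int k}" "\<bar>a - b\<bar> \<le> 1" for a b
    using arg_cong[OF tails_fps_step[where s = s, OF that], of fps_to_fls]
    by (simp add: q fls_times_fps_to_fls)
  have "Q \<noteq> 0" using s by (auto simp: Q_def)
  hence q0: "q \<noteq> 0" by (simp add: Q)
  have "fps_nth (Q^2) 0 \<noteq> fps_nth 1 0" using Q(2) by (simp add: power2_eq_square)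
  hence "Q^2 \<noteq> 1" by metis
  hence q1: "q^2 \<noteq> 1"
    unfolding Q(1) fps_to_fls_power[symmetric] by simp
  have "fps_nth (1 - 2 * Q - Q^2) 0 \<noteq> fps_nth 0 0" using Q(2) by (simp add: power2_eq_square)
  hence "1 - 2 * Q - Q^2 \<noteq> 0" by metis
  hence "fps_to_fls (1 - 2 * Q - Q^2) \<noteq> 0" by (simp only: fps_to_fls_eq_0_iff not_False_eq_True)
  hence q2: "1 - 2 * q - q^2 \<noteq> 0"
    by (simp add: Q(1) fls_times_fps_to_fls fps_to_fls_power)
  have "D (Suc m) = 1 + q * (D (Suc m) + U (Suc m) + L m)" if "m < k" for m
    using step[of "int m + 1" "int m + 1"] that by (simp add: D_def U_def L_def add_ac)
  \<comment> \<open>A third entry \<open>m - 1\<close> is too far from \<open>m + 1\<close>, so only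
    \<open>m\<close> and \<open>m + 1\<close> contribute.\<close>
  moreover have "U m = 1 + q * (L m + D (Suc m))" if "1 \<le> m" "m < k" for m
    using step[of "int m" "int m + 1"] tails_fps_eq_0[of "int m + 1" k "int m - 1" s] that
    by (simp add: D_def U_def L_def add_ac)
  moreover have "L m = 1 + q * (U m + D m)" if "1 \<le> m" "m < k" for m
    using step[of "int m + 1" "int m"] tails_fps_eq_0[of "int m" k "int m + 2" s] that
    by (simp add: D_def U_def L_def add_ac)
  moreover have "U k = 0" "L 0 = 0"
    by (simp_all add: U_def L_def tails_fps_eq_0)
  ultimately have "q * ((\<Sum>m=1..k. D m) - of_nat k) *
      ((1 - 2 * q - q^2) * (t - 1) * strip_den q t (t ^ k)) = strip_num k q t (t ^ k)"
    by (rule strip_system_sum[OF k q0 q1 q2 nz(1,2) curve nz(3,4)])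
  moreover have "(\<Sum>m=1..k. D m) = fps_to_fls (\<Sum>m=1..k. tails_fps k s (int m) (int m))"
    unfolding D_def by (rule fps_to_fls_sum)
  ultimately show ?thesis by simp
qed

text \<open>The difference doubles the odd powers and kills the even ones. By
  \<open>card_strip_paths\<close>, the coefficients at \<open>2 * N + 1\<close> count paths of
  length \<open>2 * N + 2\<close>, that is, words on \<open>N + 1\<close> columns; the factor
  \<open>fps_X\<close> restores the length.\<close>

lemma staircase_gf_split:
  "2 * fps_compose (staircase_gf k) (fps_X ^ 2) =
    fps_X * ((\<Sum>m=1..k. tails_fps k 1 (int m) (int m)) - (\<Sum>m=1..k. tails_fps k (-1) (int m) (int m)))"
  (is "_ = fps_X * (?F 1 - ?F (-1))")
proof (rule fps_ext)
  fix n
  have F: "fps_nth (?F s) j = s ^ j * (\<Sum>m=1..k. of_nat (strip_tails k j (int m) (int m)))" for s j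
    by (simp add: fps_sum_nth tails_fps_def sum_distrib_left)
  have lhs: "fps_nth (2 * fps_compose (staircase_gf k) (fps_X ^ 2)) n =
      2 * (if even n then fps_nth (staircase_gf k) (n div 2) else 0)"
    by (simp add: numeral_fps_const fps_nth_compose_X_power)
  have gf: "fps_nth (staircase_gf k) (Suc N) =
      (\<Sum>m=1..k. of_nat (strip_tails k (Suc (2 * N)) (int m) (int m)))" for N
  proof -
    have "staircase_count (RT2_verts (Suc N)) RT2_adj k =
        (\<Sum>m=1..k. strip_tails k (Suc (2 * N)) (int m) (int m))"
      using staircase_count_RT2[of "Suc N" k] card_strip_paths[of k "2 * N"] by simp
    thus ?thesis by (simp add: staircase_gf_def)
  qed
  show "fps_nth (2 * fps_compose (staircase_gf k) (fps_X ^ 2)) n =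
    fps_nth (fps_X * (?F 1 - ?F (-1))) n"
  proof (cases n)
    case 0
    thus ?thesis unfolding lhs by (simp add: staircase_gf_def)
  next
    case (Suc j)
    have rhs: "fps_nth (fps_X * (?F 1 - ?F (-1))) n =
        (1 - (-1) ^ j) * (\<Sum>m=1..k. of_nat (strip_tails k j (int m) (int m)))"
      unfolding Suc fps_X_mult_nth fps_sub_nth F by (simp add: left_diff_distrib)
    show ?thesis
    proof (cases "even j")
      case True
      thus ?thesis unfolding lhs rhs by (simp add: Suc)
    next
      case False
      then obtain N where "j = Suc (2 * N)" by (elim oddE) simp
      thus ?thesis unfolding lhs rhs by (simp add: Suc gf)
    qed
  qed
qed

theorem theorem16:
  fixes k :: nat and x t1 t2 :: "real fls"
  assumes "k \<ge> 1"
    and "x = fls_X ^ 2"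
    and "t1 = t1_fun x"
    and "t2 = t2_fun x"
  shows "fps_to_fls (fps_compose (staircase_gf k) (fps_X ^ 2)) =
    (a1_poly k x t1 t2 * t1 ^ k * t2 ^ k + a2_poly k x t1 t2 * t1 ^ k
       - a2_poly k x t2 t1 * t2 ^ k + a3_poly k x t1 t2) /
    ((t1 - 1) * (t2 - 1) * (x ^ 2 - 6 * x + 1) *
       (b1_poly x t1 t2 * t1 ^ k * t2 ^ k - b2_poly x t1 t2 * t1 ^ k
         + b2_poly x t2 t1 * t2 ^ k - b3_poly x t1 t2))"
proof -
  define q :: "real fls" where "q = fls_X"
  have q: "q = fps_to_fls (fps_const 1 * fps_X)" "- q = fps_to_fls (fps_const (-1) * fps_X)"
    by (simp_all add: q_def flip: fps_const_neg)
  have x: "x = q^2" by (simp add: q_def assms(2))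
  have sqrt_x: "fls_sqrt x = q" by (simp add: x q_def fls_sqrt_X_square)
  have q0: "q \<noteq> 0" by (simp add: q_def)
  have t1: "t1 = (x * (1 - x) - x * (1 + x) * q) / (2 * x ^ 2)
      + fls_sqrt (x * (1 + x) * (1 - x) ^ 2 + 2 * x * (x ^ 2 - 1) * q) / (2 * x * fls_X)"
    unfolding assms(3) t1_fun_def sqrt_x by (simp add: q_def)
  have t2: "t2 = (x * (1 - x) - x * (1 + x) * (- q)) / (2 * x ^ 2)
      + fls_sqrt (x * (1 + x) * (1 - x) ^ 2 + 2 * x * (x ^ 2 - 1) * (- q)) / (2 * x * fls_X)"
    unfolding assms(4) t2_fun_def sqrt_x by (simp add: q_def)
  obtain \<tau>1 where c1: "q^2 * (t1^2 + 1) = (1 - q - q^2 - q^3) * t1"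
    and \<tau>1: "q^2 * t1 = fps_to_fls \<tau>1" "fps_nth \<tau>1 0 = 1"
    using root_series[OF _ q(1) assms(2) t1] by blast
  obtain \<tau>2 where c2': "(-q)^2 * (t2^2 + 1) = (1 - (-q) - (-q)^2 - (-q)^3) * t2"
    and \<tau>2: "(-q)^2 * t2 = fps_to_fls \<tau>2" "fps_nth \<tau>2 0 = 1"
    using root_series[OF _ q(2) assms(2) t2] by blast
  have c2: "q^2 * (t2^2 + 1) = (1 + q - q^2 + q^3) * t2" using c2' by simp
  define F1 F2 where "F1 = fps_to_fls (\<Sum>m=1..k. tails_fps k 1 (int m) (int m))"
    and "F2 = fps_to_fls (\<Sum>m=1..k. tails_fps k (-1) (int m) (int m))"
  have N1: "q * (F1 - of_nat k) * ((1 - 2 * q - q^2) * (t1 - 1) * strip_den q t1 (t1 ^ k)) =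
      strip_num k q t1 (t1 ^ k)"
    unfolding F1_def using tails_fps_sum[OF assms(1) _ q(1) c1 \<tau>1] by simp
  have N2: "- q * (F2 - of_nat k) * ((1 + 2 * q - q^2) * (t2 - 1) * strip_den (- q) t2 (t2 ^ k)) =
      strip_num k (- q) t2 (t2 ^ k)"
    unfolding F2_def using tails_fps_sum[OF assms(1) _ q(2) c2' \<tau>2] by simp
  have "fps_to_fls (2 * fps_compose (staircase_gf k) (fps_X ^ 2)) = q * (F1 - F2)"
    unfolding staircase_gf_split F1_def F2_def by (simp add: q_def fls_times_fps_to_fls)
  hence gf: "2 * fps_to_fls (fps_compose (staircase_gf k) (fps_X ^ 2)) = q * (F1 - F2)"
    by (simp add: fls_times_fps_to_fls)
  have Q: "q = fps_to_fls fps_X" "fps_nth (fps_X :: real fps) 0 = 0"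
    "- q = fps_to_fls (- fps_X)" "fps_nth (- fps_X :: real fps) 0 = 0"
    by (simp_all add: q_def)
  note nz1 = large_root_nonvanishing[OF Q(1,2) \<tau>1] and nz2 = large_root_nonvanishing[OF Q(3,4) \<tau>2]
  \<comment> \<open>Both series have constant term 1.\<close>
  have "fps_nth (1 + fps_X^2 :: real fps) 0 \<noteq> 0" "fps_nth ((fps_X^2)^2 - 6 * fps_X^2 + 1 :: real fps) 0 \<noteq> 0"
    by simp_all
  hence "(1 + fps_X^2 :: real fps) \<noteq> 0" "((fps_X^2)^2 - 6 * fps_X^2 + 1 :: real fps) \<noteq> 0"
    by (metis fps_zero_nth)+
  moreover have "1 + q^2 = fps_to_fls (1 + fps_X^2)" "x^2 - 6 * x + 1 = fps_to_fls ((fps_X^2)^2 - 6 * fps_X^2 + 1)"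
    by (simp_all add: x q_def fls_times_fps_to_fls fps_to_fls_power)
  ultimately have x1: "1 + q^2 \<noteq> 0" and x2: "x^2 - 6 * x + 1 \<noteq> 0"
    by (simp_all del: fps_to_fls_plus)
  have t_ne: "t1 - 1 \<noteq> 0" "t2 - 1 \<noteq> 0" using nz1(2) nz2(2) by auto
  define num where "num = a1_poly k x t1 t2 * t1 ^ k * t2 ^ k + a2_poly k x t1 t2 * t1 ^ k
       - a2_poly k x t2 t1 * t2 ^ k + a3_poly k x t1 t2"
  define den where "den = b1_poly x t1 t2 * t1 ^ k * t2 ^ k - b2_poly x t1 t2 * t1 ^ k
         + b2_poly x t2 t1 * t2 ^ k - b3_poly x t1 t2"
  define d1 d2 where "d1 = strip_den q t1 (t1 ^ k)" and "d2 = strip_den (- q) t2 (t2 ^ k)"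
  have den: "den = -2 * q * (1 + q^2)^2 * t1 * t2 * (d1 * d2)"
    unfolding den_def d1_def d2_def x by (rule strip_den_product[OF q0 c1 c2])
  have num: "2 * num = -2 * q * (1 + q^2)^2 * t1 * t2 *
      (q * (F1 - of_nat k) * ((1 - 2 * q - q^2) * (t1 - 1) * d1) * (1 + 2 * q - q^2) * (t2 - 1) * d2
       + - q * (F2 - of_nat k) * ((1 + 2 * q - q^2) * (t2 - 1) * d2) * (1 - 2 * q - q^2) * (t1 - 1) * d1)"
    unfolding num_def d1_def d2_def N1 N2 unfolding x by (rule strip_num_combination[OF q0 c1 c2])
  \<comment> \<open>The terms with \<open>of_nat k\<close> cancel, and
    \<open>(1 - 2 * q - q^2) * (1 + 2 * q - q^2) = x^2 - 6 * x + 1\<close>. The common factor of the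
    printed coefficients is absorbed into \<open>den\<close>.\<close>
  have "2 * num = q * (F1 - F2) * ((t1 - 1) * (t2 - 1) * (x^2 - 6 * x + 1) * den)"
    unfolding num den x by algebra
  also have "\<dots> = 2 * (fps_to_fls (fps_compose (staircase_gf k) (fps_X ^ 2)) *
      ((t1 - 1) * (t2 - 1) * (x^2 - 6 * x + 1) * den))"
    unfolding gf[symmetric] by (simp only: mult.assoc)
  finally have "num = fps_to_fls (fps_compose (staircase_gf k) (fps_X ^ 2)) *
      ((t1 - 1) * (t2 - 1) * (x^2 - 6 * x + 1) * den)"
    by simp
  moreover have "(t1 - 1) * (t2 - 1) * (x^2 - 6 * x + 1) * den \<noteq> 0"
    using q0 x1 x2 t_ne nz1(1,4) nz2(1,4) by (simp add: den d1_def d2_def)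
  ultimately show ?thesis unfolding num_def den_def by (simp add: eq_divide_eq)
qed

end
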